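(* Let $G=C_2\wr\mathbb{Z}$. Let $f:\mathbb{N}\to\mathbb{R}_+$ be a non-decreasing function, with positive values, such that $f(n+1)/f(n)$ is non-increasing. Then there exists a faithful and transitive $G$-set $X$ such that $\mathrm{vol}_{G,X}(n)\simeq n f(n)$. In particular: - for every real number $\alpha\ge 1$, there exists a faithful $G$-set $X$ with $\mathrm{vol}_{G,X}(n)\simeq n^\alpha$; - for every $0<\beta\le 1$, there exists a faithful $G$-set $X$ with $\mathrm{vol}_{G,X}(n)\simeq\exp(n^\beta)$.
   Context: $C_2$ is the cyclic group of order $2$; the wreath product $A\wr B$ is the semidirect product $\left(\bigoplus_B A\right)\rtimes B$, where $\bigoplus_B A$ is the group of finitely supported functions $B\to A$ and $B$ acts by translation. Let $G$ be a finitely generated group, $S$ a finite symmetric generating set, and $|\cdot|_S$ the word length. A $G$-set is a non-empty set with a $G$-action; it is faithful if only the identity of $G$ acts trivially. The growth of the action of $G$ on a $G$-set $X$ is $\mathrm{vol}_{G,X}(n)=\max_{x\in X}|\{gx : g\in G,\ |g|_S\le n\}|$. For functions $f,g$ from $\mathbb{N}$ to the non-negative reals, $f(n)\preccurlyeq g(n)$ means that there is a constant $C>0$ (which may be taken to be an integer) such that $f(n)\le C g(Cn)$ for all sufficiently large $n$; $f\simeq g$ means $f\preccurlyeq g$ and $g\preccurlyeq f$. Up to $\simeq$, $\mathrm{vol}_{G,X}$ does not depend on $S$. *)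

theory Defs
  imports Complex_Main "HOL-Algebra.Group_Action" "HOL-Algebra.Product_Groups"
begin

section \<open>Wreath products\<close>

definition semidirect_product ::
    "('n, 'c) monoid_scheme \<Rightarrow> ('h, 'd) monoid_scheme \<Rightarrow> ('h \<Rightarrow> 'n \<Rightarrow> 'n) \<Rightarrow> ('n \<times> 'h) monoid" where
  "semidirect_product N H \<theta> =
     \<lparr>carrier = carrier N \<times> carrier H,
      mult = (\<lambda>(u, b) (v, c). (u \<otimes>\<^bsub>N\<^esub> \<theta> b v, b \<otimes>\<^bsub>H\<^esub> c)),
      one = (\<one>\<^bsub>N\<^esub>, \<one>\<^bsub>H\<^esub>)\<rparr>"

text \<open>The restriction is needed because the elements of \<^const>\<open>sum_group\<close> are extensional
  functions on the index set.\<close>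

definition translate :: "('b, 'd) monoid_scheme \<Rightarrow> 'b \<Rightarrow> ('b \<Rightarrow> 'a) \<Rightarrow> 'b \<Rightarrow> 'a" where
  "translate B b u = (\<lambda>x\<in>carrier B. u (inv\<^bsub>B\<^esub> b \<otimes>\<^bsub>B\<^esub> x))"

definition wreath_product ::
    "('a, 'c) monoid_scheme \<Rightarrow> ('b, 'd) monoid_scheme \<Rightarrow> (('b \<Rightarrow> 'a) \<times> 'b) monoid" where
  "wreath_product A B =
     semidirect_product (sum_group (carrier B) (\<lambda>_. A)) B (translate B)"

type_synonym lamplighter_elem = "(int \<Rightarrow> int) \<times> int"

text \<open>Every transitive action of a group is isomorphic to one on a set of cosets, so
  \<open>lamplighter_elem set\<close> is large enough to serve as a type of points.\<close>

definition lamplighter :: "lamplighter_elem monoid" where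
  "lamplighter = wreath_product (integer_mod_group 2) integer_group"


section \<open>Word length and growth of actions\<close>

definition fin_sym_gen_set :: "('a, 'c) monoid_scheme \<Rightarrow> 'a set \<Rightarrow> bool" where
  "fin_sym_gen_set G S \<longleftrightarrow>
     finite S \<and> S \<subseteq> carrier G \<and> (\<forall>s\<in>S. inv\<^bsub>G\<^esub> s \<in> S) \<and> generate G S = carrier G"

definition word_length :: "('a, 'c) monoid_scheme \<Rightarrow> 'a set \<Rightarrow> 'a \<Rightarrow> nat" where
  "word_length G S g =
     (LEAST n. \<exists>ws. set ws \<subseteq> S \<and> length ws = n \<and> foldr (\<otimes>\<^bsub>G\<^esub>) ws \<one>\<^bsub>G\<^esub> = g)"

text \<open>The set whose maximum is taken is finite when \<open>S\<close> is a finite generating set, since all its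
  elements are bounded by the cardinality of the ball of radius \<open>n\<close>, even if \<open>X\<close> is infinite.\<close>

definition action_growth ::
    "('a, 'c) monoid_scheme \<Rightarrow> 'a set \<Rightarrow> 'x set \<Rightarrow> ('a \<Rightarrow> 'x \<Rightarrow> 'x) \<Rightarrow> nat \<Rightarrow> nat" where
  "action_growth G S X \<phi> n =
     Max ((\<lambda>x. card {\<phi> g x | g. g \<in> carrier G \<and> word_length G S g \<le> n}) ` X)"

definition growth_le :: "(nat \<Rightarrow> real) \<Rightarrow> (nat \<Rightarrow> real) \<Rightarrow> bool" where
  "growth_le f g \<longleftrightarrow>
     (\<exists>C::nat. C > 0 \<and> (\<forall>\<^sub>F n in sequentially. f n \<le> real C * g (C * n)))"

definition growth_equiv :: "(nat \<Rightarrow> real) \<Rightarrow> (nat \<Rightarrow> real) \<Rightarrow> bool" where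
  "growth_equiv f g \<longleftrightarrow> growth_le f g \<and> growth_le g f"

text \<open>The growth of an action of a finitely generated group is only defined up to
  \<^const>\<open>growth_equiv\<close>, independently of the generating set; we ask for the
  equivalence with respect to every finite symmetric generating set.\<close>

definition has_action_growth ::
    "('a, 'c) monoid_scheme \<Rightarrow> 'x set \<Rightarrow> ('a \<Rightarrow> 'x \<Rightarrow> 'x) \<Rightarrow> (nat \<Rightarrow> real) \<Rightarrow> bool" where
  "has_action_growth G X \<phi> F \<longleftrightarrow>
     (\<forall>S. fin_sym_gen_set G S \<longrightarrow> growth_equiv (\<lambda>n. real (action_growth G S X \<phi> n)) F)"


section \<open>The lamplighter group is a finitely generated group\<close>

lemma carrier_lamplighter:
  "carrier lamplighter = {u. range u \<subseteq> {0, 1} \<and> finite {i. u i \<noteq> 0}} \<times> UNIV"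
proof -
  have "{0..<2::int} = {0, 1}" by auto
  then show ?thesis
    by (auto simp: lamplighter_def wreath_product_def semidirect_product_def carrier_sum_group
        carrier_integer_mod_group carrier_integer_group PiE_iff)
qed

lemma mult_lamplighter:
  "(u, b) \<otimes>\<^bsub>lamplighter\<^esub> (v, c) = ((\<lambda>i. (u i + v (i - b)) mod 2), b + c)"
  by (simp add: lamplighter_def wreath_product_def semidirect_product_def translate_def
      inv_integer_group carrier_integer_group restrict_def fun_eq_iff)

lemma one_lamplighter: "\<one>\<^bsub>lamplighter\<^esub> = ((\<lambda>_. 0), 0)"
  by (simp add: lamplighter_def wreath_product_def semidirect_product_def restrict_def
      carrier_integer_group one_integer_group)

lemma group_lamplighter: "group lamplighter"
proof (rule groupI)
  fix x y assume "x \<in> carrier lamplighter" "y \<in> carrier lamplighter"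
  then obtain u b v c where xy: "x = (u, b)" "y = (v, c)"
    and u: "range u \<subseteq> {0, 1}" "finite {i. u i \<noteq> 0}"
    and v: "range v \<subseteq> {0, 1}" "finite {i. v i \<noteq> 0}"
    by (auto simp: carrier_lamplighter)
  have "{i. (u i + v (i - b)) mod 2 \<noteq> 0} \<subseteq> {i. u i \<noteq> 0} \<union> (\<lambda>i. i + b) ` {i. v i \<noteq> 0}"
  proof
    fix i assume "i \<in> {i. (u i + v (i - b)) mod 2 \<noteq> 0}"
    then have "u i \<noteq> 0 \<or> v (i - b) \<noteq> 0" by auto
    moreover have "i = (i - b) + b" by simp
    ultimately show "i \<in> {i. u i \<noteq> 0} \<union> (\<lambda>i. i + b) ` {i. v i \<noteq> 0}" by blast
  qed
  then have "finite {i. (u i + v (i - b)) mod 2 \<noteq> 0}"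
    by (rule finite_subset) (use u v in auto)
  moreover have "range (\<lambda>i. (u i + v (i - b)) mod 2) \<subseteq> {0, 1}" by auto
  ultimately show "x \<otimes>\<^bsub>lamplighter\<^esub> y \<in> carrier lamplighter"
    unfolding xy mult_lamplighter by (simp add: carrier_lamplighter)
next
  show "\<one>\<^bsub>lamplighter\<^esub> \<in> carrier lamplighter"
    by (auto simp: carrier_lamplighter one_lamplighter)
next
  fix x y z
  show "x \<otimes>\<^bsub>lamplighter\<^esub> y \<otimes>\<^bsub>lamplighter\<^esub> z = x \<otimes>\<^bsub>lamplighter\<^esub> (y \<otimes>\<^bsub>lamplighter\<^esub> z)"
    by (cases x; cases y; cases z)
      (simp add: mult_lamplighter fun_eq_iff mod_simps algebra_simps)
next
  fix x assume "x \<in> carrier lamplighter"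
  then obtain u b where x: "x = (u, b)" and u: "range u \<subseteq> {0, 1}" "finite {i. u i \<noteq> 0}"
    by (auto simp: carrier_lamplighter)
  have u01: "u i = 0 \<or> u i = 1" for i using u by auto
  have *: "u i mod 2 = u i" for i using u01[of i] by auto
  then show "\<one>\<^bsub>lamplighter\<^esub> \<otimes>\<^bsub>lamplighter\<^esub> x = x"
    unfolding x one_lamplighter mult_lamplighter by simp
  have eq: "{i. u (i + b) \<noteq> 0} = (\<lambda>i. i - b) ` {i. u i \<noteq> 0}"
    by (auto simp: image_iff intro!: exI[of _ "_ + b"])
  have "finite {i. u (i + b) \<noteq> 0}"
    unfolding eq using u by auto
  then have "((\<lambda>i. u (i + b)), - b) \<in> carrier lamplighter"
    using u01 by (auto simp: carrier_lamplighter)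
  moreover have "((\<lambda>i. u (i + b)), - b) \<otimes>\<^bsub>lamplighter\<^esub> x = \<one>\<^bsub>lamplighter\<^esub>"
    unfolding x one_lamplighter mult_lamplighter by (simp add: fun_eq_iff)
  ultimately show "\<exists>y\<in>carrier lamplighter. y \<otimes>\<^bsub>lamplighter\<^esub> x = \<one>\<^bsub>lamplighter\<^esub>"
    by blast
qed

lemma fin_sym_gen_set_lamplighter: "\<exists>S. fin_sym_gen_set lamplighter S"
proof -
  interpret L: group lamplighter by (rule group_lamplighter)
  define t :: "int \<Rightarrow> lamplighter_elem" where "t b = ((\<lambda>_. 0), b)" for b
  define a :: "int \<Rightarrow> lamplighter_elem" where "a k = ((\<lambda>i. if i = k then 1 else 0), 0)" for k
  define S where "S = {t 1, t (- 1), a 0}"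
  have tc: "t b \<in> carrier lamplighter" for b
    by (auto simp: t_def carrier_lamplighter)
  have ac: "a b \<in> carrier lamplighter" for b
    by (auto simp: a_def carrier_lamplighter)
  have tt: "t b \<otimes>\<^bsub>lamplighter\<^esub> t c = t (b + c)" for b c
    by (simp add: t_def mult_lamplighter)
  have tat: "t b \<otimes>\<^bsub>lamplighter\<^esub> a 0 \<otimes>\<^bsub>lamplighter\<^esub> t (- b) = a b" for b
    by (simp add: t_def a_def mult_lamplighter fun_eq_iff)
  have t0: "t 0 = \<one>\<^bsub>lamplighter\<^esub>" by (simp add: t_def one_lamplighter)
  have aa: "a 0 \<otimes>\<^bsub>lamplighter\<^esub> a 0 = \<one>\<^bsub>lamplighter\<^esub>"
    by (simp add: a_def mult_lamplighter one_lamplighter fun_eq_iff)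
  have inva: "inv\<^bsub>lamplighter\<^esub> (a 0) = a 0"
    by (rule L.inv_equality) (use aa ac in auto)
  have invt: "inv\<^bsub>lamplighter\<^esub> (t b) = t (- b)" for b
    by (rule L.inv_equality) (use tc tt t0 in auto)
  have SC: "S \<subseteq> carrier lamplighter" using tc ac by (auto simp: S_def)
  have gm: "x \<otimes>\<^bsub>lamplighter\<^esub> y \<in> generate lamplighter S"
    if "x \<in> generate lamplighter S" "y \<in> generate lamplighter S" for x y
    using that by (rule generate.eng)
  have gS: "s \<in> generate lamplighter S" if "s \<in> S" for s using that by (rule generate.incl)
  have tn: "t (int n) \<in> generate lamplighter S \<and> t (- int n) \<in> generate lamplighter S" for n
  proof (induction n)
    case 0
    then show ?case using t0 generate.one[of lamplighter S] by simp
  next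
    case (Suc n)
    then show ?case
      using gm[of "t 1" "t (int n)"] gm[of "t (-1)" "t (- int n)"] gS[of "t 1"] gS[of "t (-1)"]
      by (simp add: tt S_def)
  qed
  have tg: "t b \<in> generate lamplighter S" for b
    using tn[of "nat \<bar>b\<bar>"] by (cases "b \<ge> 0") auto
  have ag: "a b \<in> generate lamplighter S" for b
    using gm[OF gm[OF tg[of b] gS[of "a 0"]] tg[of "- b"]] tat[of b] by (simp add: S_def)
  have ug: "((\<lambda>i. if i \<in> T then 1 else 0), 0) \<in> generate lamplighter S" if "finite T" for T
    using that
  proof (induction T)
    case empty
    then show ?case using generate.one[of lamplighter S] by (simp add: one_lamplighter)
  next
    case (insert k T)
    have "a k \<otimes>\<^bsub>lamplighter\<^esub> ((\<lambda>i. if i \<in> T then 1 else 0), 0)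
        = ((\<lambda>i. if i \<in> insert k T then 1 else 0), 0)"
      using insert.hyps by (auto simp: a_def mult_lamplighter fun_eq_iff)
    then show ?case using gm[OF ag[of k] insert.IH] by simp
  qed
  have "x \<in> generate lamplighter S" if "x \<in> carrier lamplighter" for x
  proof -
    obtain u b where x: "x = (u, b)" and u: "range u \<subseteq> {0, 1}" "finite {i. u i \<noteq> 0}"
      using \<open>x \<in> carrier lamplighter\<close> by (auto simp: carrier_lamplighter)
    have u01: "u i = 0 \<or> u i = 1" for i using u by auto
    have "((\<lambda>i. if i \<in> {i. u i \<noteq> 0} then 1 else 0), 0) \<otimes>\<^bsub>lamplighter\<^esub> t b = x"
      unfolding x t_def mult_lamplighter using u01 by (fastforce simp: fun_eq_iff)
    then show ?thesis using gm[OF ug[OF u(2)] tg[of b]] by simp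
  qed
  then have "generate lamplighter S = carrier lamplighter"
    using L.generate_incl[OF SC] by blast
  then have "fin_sym_gen_set lamplighter S"
    unfolding fin_sym_gen_set_def using SC inva invt by (auto simp: S_def)
  then show ?thesis by blast
qed

end

theory Submission
  imports Defs "HOL-Real_Asymp.Real_Asymp"
begin

text \<open>Let a lamplighter walk on the integers with lamps only at the points of a set \<open>A\<close>. This is a
  transitive action of the lamplighter group, faithful as soon as \<open>A\<close> is non-empty. In \<open>n\<close> steps
  the walker reaches about \<open>n\<close> positions and can only switch lamps in a window whose length is
  linear in \<open>n\<close>, so the growth is \<open>n * 2 ^ w n\<close>, up to \<^const>\<open>growth_equiv\<close>, where \<open>w n\<close> is the
  largest number of lamps in a window of length \<open>n\<close>. Since \<open>log 2 (f n)\<close> is concave and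
  non-decreasing, a suitable \<open>A\<close>, densest near 0, has \<open>w n\<close> equal to \<open>log 2 (f n)\<close> up to a bounded
  error and a rescaling of \<open>n\<close>; the rescaling makes room when the slope of \<open>log 2 (f n)\<close> exceeds 1.\<close>

section \<open>Word length\<close>

context group
begin

lemma foldr_mult_closed:
  "set ws \<subseteq> carrier G \<Longrightarrow> foldr (\<otimes>) ws \<one> \<in> carrier G"
  by (induction ws) auto

lemma foldr_mult_append:
  "\<lbrakk>set xs \<subseteq> carrier G; set ys \<subseteq> carrier G\<rbrakk> \<Longrightarrow>
    foldr (\<otimes>) (xs @ ys) \<one> = foldr (\<otimes>) xs \<one> \<otimes> foldr (\<otimes>) ys \<one>"
  by (induction xs) (auto simp: m_assoc foldr_mult_closed)

text \<open>\<open>generate\<close> closes under inverses while words use letters of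
  \<open>S\<close> only; the symmetry of \<open>S\<close> makes each inverse of a generator a letter
  again.\<close>

lemma word_exists:
  assumes S: "fin_sym_gen_set G S" and g: "g \<in> carrier G"
  shows "\<exists>ws. set ws \<subseteq> S \<and> foldr (\<otimes>) ws \<one> = g"
proof -
  have SC: "S \<subseteq> carrier G" and inv: "\<And>s. s \<in> S \<Longrightarrow> inv s \<in> S"
    and "g \<in> generate G S"
    using S g by (auto simp: fin_sym_gen_set_def)
  from this(3) show ?thesis
  proof induction
    case one
    then show ?case by (intro exI[of _ "[]"]) auto
  next
    case (incl h)
    then show ?case using SC by (intro exI[of _ "[h]"]) auto
  next
    case (inv h)
    then show ?case using SC \<open>\<And>s. s \<in> S \<Longrightarrow> inv s \<in> S\<close>[of h] by (intro exI[of _ "[inv h]"]) auto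
  next
    case (eng h1 h2)
    then obtain xs ys where "set xs \<subseteq> S" "foldr (\<otimes>) xs \<one> = h1" "set ys \<subseteq> S" "foldr (\<otimes>) ys \<one> = h2"
      by blast
    then show ?case
      using foldr_mult_append[of xs ys] SC by (intro exI[of _ "xs @ ys"]) auto
  qed
qed

lemma obtain_geodesic_word:
  assumes "fin_sym_gen_set G S" and "g \<in> carrier G"
  obtains ws where "set ws \<subseteq> S" "foldr (\<otimes>) ws \<one> = g" "length ws = word_length G S g"
proof -
  have "\<exists>n ws. set ws \<subseteq> S \<and> length ws = n \<and> foldr (\<otimes>) ws \<one> = g"
    using word_exists[OF assms] by blast
  from LeastI_ex[OF this] show ?thesis
    using that unfolding word_length_def by blast
qed

lemma word_length_le:
  "\<lbrakk>set ws \<subseteq> S; foldr (\<otimes>) ws \<one> = g\<rbrakk> \<Longrightarrow> word_length G S g \<le> length ws"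
  unfolding word_length_def by (rule Least_le) blast

lemma word_length_one: "word_length G S \<one> = 0"
  using word_length_le[of "[]" S \<one>] by simp

lemma word_length_mult_le:
  assumes S: "fin_sym_gen_set G S" and "g \<in> carrier G" "h \<in> carrier G"
  shows "word_length G S (g \<otimes> h) \<le> word_length G S g + word_length G S h"
proof -
  obtain xs where xs: "set xs \<subseteq> S" "foldr (\<otimes>) xs \<one> = g" "length xs = word_length G S g"
    using obtain_geodesic_word assms by blast
  obtain ys where ys: "set ys \<subseteq> S" "foldr (\<otimes>) ys \<one> = h" "length ys = word_length G S h"
    using obtain_geodesic_word assms by blast
  have "S \<subseteq> carrier G" using S by (simp add: fin_sym_gen_set_def)
  then have "word_length G S (g \<otimes> h) \<le> length (xs @ ys)"
    using xs ys foldr_mult_append[of xs ys] by (intro word_length_le) auto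
  then show ?thesis using xs ys by simp
qed

text \<open>Bijectivity comes for free, since \<open>\<phi> (inv g)\<close> undoes
  \<open>\<phi> g\<close>. Extensionality is required because the elements of
  \<open>BijGroup E\<close> are extensional, and it turns the pointwise law for products into an
  equality of functions.\<close>

lemma group_actionI:
  assumes ext: "\<And>g. g \<in> carrier G \<Longrightarrow> \<phi> g \<in> extensional E"
    and closed: "\<And>g x. \<lbrakk>g \<in> carrier G; x \<in> E\<rbrakk> \<Longrightarrow> \<phi> g x \<in> E"
    and one: "\<And>x. x \<in> E \<Longrightarrow> \<phi> \<one> x = x"
    and mult: "\<And>g h x. \<lbrakk>g \<in> carrier G; h \<in> carrier G; x \<in> E\<rbrakk> \<Longrightarrow> \<phi> (g \<otimes> h) x = \<phi> g (\<phi> h x)"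
  shows "group_action G E \<phi>"
proof -
  have Bij: "\<phi> g \<in> Bij E" if g: "g \<in> carrier G" for g
  proof -
    have "bij_betw (\<phi> g) E E"
      by (rule bij_betw_byWitness[where f' = "\<phi> (inv g)"])
        (use g closed one mult[of g "inv g"] mult[of "inv g" g] in auto)
    then show ?thesis using ext[OF g] by (simp add: Bij_def)
  qed
  have "\<phi> (g \<otimes> h) = compose E (\<phi> g) (\<phi> h)" if "g \<in> carrier G" "h \<in> carrier G" for g h
    by (rule extensionalityI[of _ E]) (use that ext mult in \<open>auto simp: compose_eq\<close>)
  then have "\<phi> \<in> hom G (BijGroup E)"
    using Bij by (auto simp: hom_def BijGroup_def)
  then show ?thesis
    by (simp add: group_action_def group_hom_def group_hom_axioms_def group_BijGroup)
qed

end

section \<open>The lamplighter group\<close>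

definition lamps :: "int set \<Rightarrow> int \<Rightarrow> int" where
  "lamps T = (\<lambda>i. of_bool (i \<in> T))"

lemma lamps_in_carrier [simp]: "(lamps T, b) \<in> carrier lamplighter \<longleftrightarrow> finite T"
  by (auto simp: carrier_lamplighter lamps_def)

lemma lamplighter_cases:
  assumes "x \<in> carrier lamplighter"
  obtains T b where "finite T" "x = (lamps T, b)"
proof -
  obtain u b where x: "x = (u, b)" by (cases x)
  have "u i = 0 \<or> u i = 1" for i
    using assms x by (auto simp: carrier_lamplighter)
  then have "u = lamps {i. u i \<noteq> 0}"
    by (force simp: lamps_def fun_eq_iff)
  moreover have "finite {i. u i \<noteq> 0}" using assms x by (auto simp: carrier_lamplighter)
  ultimately show ?thesis using that x by blast
qed

lemma mult_lamplighter_eq: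
  "g \<otimes>\<^bsub>lamplighter\<^esub> h = ((\<lambda>i. (fst g i + fst h (i - snd g)) mod 2), snd g + snd h)"
  by (metis mult_lamplighter prod.collapse)

lemma one_lamplighter_eq: "\<one>\<^bsub>lamplighter\<^esub> = (lamps {}, 0)"
  by (simp add: one_lamplighter lamps_def)

lemma lamps_mult_shift:
  "(lamps T, b) \<otimes>\<^bsub>lamplighter\<^esub> (lamps {}, c) = (lamps T, b + c)"
  by (auto simp: mult_lamplighter lamps_def fun_eq_iff)

lemma lamps_mult_switch:
  "b \<notin> T \<Longrightarrow> (lamps T, b) \<otimes>\<^bsub>lamplighter\<^esub> (lamps {0}, 0) = (lamps (insert b T), b)"
  by (auto simp: mult_lamplighter lamps_def fun_eq_iff)

text \<open>\<open>R\<close> bounds the shift and the lit lamps of each of the finitely many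
  generators. Putting one more letter in front of a word moves the lamps of the word by the shift of
  the letter and adds the lamps of the letter, so every bound grows by at most
  \<open>R\<close>.\<close>

lemma word_length_lamplighter_support:
  assumes S: "fin_sym_gen_set lamplighter S"
  obtains R :: nat where "R > 0"
    "\<And>g. g \<in> carrier lamplighter \<Longrightarrow> \<bar>snd g\<bar> \<le> int (R * word_length lamplighter S g)"
    "\<And>g i. \<lbrakk>g \<in> carrier lamplighter; fst g i \<noteq> 0\<rbrakk> \<Longrightarrow> \<bar>i\<bar> \<le> int (R * word_length lamplighter S g)"
proof -
  interpret L: group lamplighter by (rule group_lamplighter)
  have SC: "S \<subseteq> carrier lamplighter" and finS: "finite S"
    using S by (auto simp: fin_sym_gen_set_def)
  define Z where "Z = snd ` S \<union> (\<Union>s\<in>S. {i. fst s i \<noteq> 0})"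
  have "finite Z"
    unfolding Z_def using finS SC by (fastforce simp: carrier_lamplighter)
  \<comment> \<open>The sum serves as a crude maximum; \<open>Suc\<close> makes \<open>R\<close>
    positive at once.\<close>
  define R where "R = Suc (\<Sum>i\<in>Z. nat \<bar>i\<bar>)"
  have R: "\<bar>i\<bar> \<le> int R" if "i \<in> Z" for i
  proof -
    have "nat \<bar>i\<bar> \<le> (\<Sum>i\<in>Z. nat \<bar>i\<bar>)" using that \<open>finite Z\<close> by (intro member_le_sum) auto
    then show ?thesis unfolding R_def by linarith
  qed
  have words: "\<bar>snd (foldr (\<otimes>\<^bsub>lamplighter\<^esub>) ws \<one>\<^bsub>lamplighter\<^esub>)\<bar> \<le> int (R * length ws) \<and>
      (\<forall>i. fst (foldr (\<otimes>\<^bsub>lamplighter\<^esub>) ws \<one>\<^bsub>lamplighter\<^esub>) i \<noteq> 0 \<longrightarrow> \<bar>i\<bar> \<le> int (R * length ws))"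
    if "set ws \<subseteq> S" for ws
    using that
  proof (induction ws)
    case Nil
    then show ?case by (simp add: one_lamplighter)
  next
    case (Cons s ws)
    define h where "h = foldr (\<otimes>\<^bsub>lamplighter\<^esub>) ws \<one>\<^bsub>lamplighter\<^esub>"
    have IH: "\<bar>snd h\<bar> \<le> int (R * length ws)"
      "\<And>i. fst h i \<noteq> 0 \<Longrightarrow> \<bar>i\<bar> \<le> int (R * length ws)"
      using Cons by (auto simp: h_def)
    have s: "\<bar>snd s\<bar> \<le> int R" "\<And>i. fst s i \<noteq> 0 \<Longrightarrow> \<bar>i\<bar> \<le> int R"
      using Cons.prems by (auto intro!: R simp: Z_def)
    have *: "\<bar>i\<bar> \<le> int R + int (R * length ws)" if "(fst s i + fst h (i - snd s)) mod 2 \<noteq> 0" for i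
    proof -
      have "fst s i \<noteq> 0 \<or> fst h (i - snd s) \<noteq> 0" using that by auto
      then show ?thesis using s(1) s(2)[of i] IH(2)[of "i - snd s"] by linarith
    qed
    have eq: "foldr (\<otimes>\<^bsub>lamplighter\<^esub>) (s # ws) \<one>\<^bsub>lamplighter\<^esub> =
        ((\<lambda>i. (fst s i + fst h (i - snd s)) mod 2), snd s + snd h)"
      by (simp add: h_def flip: mult_lamplighter_eq)
    have "\<bar>snd s + snd h\<bar> \<le> int R + int (R * length ws)" using s(1) IH(1) by linarith
    then show ?case unfolding eq using * by simp
  qed
  show ?thesis
  proof (rule that[of R])
    show "R > 0" by (simp add: R_def)
  next
    fix g assume "g \<in> carrier lamplighter"
    then show "\<bar>snd g\<bar> \<le> int (R * word_length lamplighter S g)"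
      using L.obtain_geodesic_word[OF S] words by metis
  next
    fix g i assume "g \<in> carrier lamplighter" "fst g i \<noteq> 0"
    then show "\<bar>i\<bar> \<le> int (R * word_length lamplighter S g)"
      using L.obtain_geodesic_word[OF S] words by metis
  qed
qed

text \<open>Sweep from 0 to \<open>m\<close>, switching the lamps of \<open>T\<close> on the way,
  then walk back to \<open>b\<close>. The sweep costs at most one switch and one step per site and
  the return at most \<open>m\<close> steps, whatever \<open>T\<close> is; this is the factor 2 in
  the constant \<open>2 * D\<close>.\<close>

lemma word_length_lamplighter_upper:
  assumes S: "fin_sym_gen_set lamplighter S"
  obtains D :: nat where "D > 0"
    "\<And>T b m. \<lbrakk>T \<subseteq> {0..<int m}; 0 \<le> b; b \<le> int m\<rbrakk> \<Longrightarrow>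
       word_length lamplighter S (lamps T, b) \<le> D * m"
proof -
  interpret L: group lamplighter by (rule group_lamplighter)
  let ?wl = "word_length lamplighter S"
  let ?t = "(lamps {}, 1)" and ?t' = "(lamps {}, - 1)" and ?a = "(lamps {0}, 0)"
  define D where "D = Suc (?wl ?t + ?wl ?t' + ?wl ?a)"
  have D: "?wl ?t + ?wl ?a \<le> D" "?wl ?t' \<le> D" by (auto simp: D_def)
  have sweep: "?wl (lamps T, int m) \<le> D * m" if "T \<subseteq> {0..<int m}" for T m
    using that
  proof (induction m arbitrary: T)
    case 0
    then show ?case using L.word_length_one[of S] by (simp add: one_lamplighter_eq)
  next
    case (Suc m)
    define T' where "T' = T - {int m}"
    have T': "T' \<subseteq> {0..<int m}" using Suc.prems by (auto simp: T'_def)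
    then have "finite T'" by (rule finite_subset) simp
    then have "finite T" by (simp add: T'_def)
    have "?wl (lamps T, int m) \<le> D * m + ?wl ?a"
    proof (cases "int m \<in> T")
      case True
      then have "(lamps T, int m) = (lamps T', int m) \<otimes>\<^bsub>lamplighter\<^esub> ?a"
        by (subst lamps_mult_switch) (auto simp: T'_def insert_absorb)
      then show ?thesis
        using L.word_length_mult_le[OF S, of "(lamps T', int m)" ?a] \<open>finite T'\<close> Suc.IH[OF T'] by simp
    next
      case False
      then have "T' = T" by (simp add: T'_def)
      then show ?thesis using Suc.IH[OF T'] by simp
    qed
    moreover have "?wl (lamps T, int (Suc m)) \<le> ?wl (lamps T, int m) + ?wl ?t"
      using L.word_length_mult_le[OF S, of "(lamps T, int m)" ?t] \<open>finite T\<close>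
      by (simp add: lamps_mult_shift add.commute)
    ultimately show ?case using D by simp
  qed
  have return: "?wl (lamps {}, - int k) \<le> D * k" for k
  proof (induction k)
    case 0
    then show ?case using L.word_length_one[of S] by (simp add: one_lamplighter_eq)
  next
    case (Suc k)
    have "?wl (lamps {}, - int (Suc k)) \<le> ?wl (lamps {}, - int k) + ?wl ?t'"
      using L.word_length_mult_le[OF S, of "(lamps {}, - int k)" ?t']
      by (simp add: lamps_mult_shift add.commute)
    then show ?case using Suc D by simp
  qed
  show ?thesis
  proof (rule that[of "2 * D"])
    show "2 * D > 0" by (simp add: D_def)
  next
    fix T b and m :: nat
    assume T: "T \<subseteq> {0..<int m}" and b: "0 \<le> b" "b \<le> int m"
    have "finite T" using T by (rule finite_subset) simp
    define k where "k = nat (int m - b)"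
    have k: "b = int m - int k" "k \<le> m" using b by (auto simp: k_def)
    have "?wl (lamps T, b) \<le> ?wl (lamps T, int m) + ?wl (lamps {}, - int k)"
      using L.word_length_mult_le[OF S, of "(lamps T, int m)" "(lamps {}, - int k)"] \<open>finite T\<close>
      by (simp add: lamps_mult_shift k)
    also have "\<dots> \<le> D * m + D * k" using sweep[OF T] return[of k] by simp
    also have "\<dots> \<le> 2 * D * m" using k(2) by simp
    finally show "?wl (lamps T, b) \<le> 2 * D * m" .
  qed
qed

section \<open>Lamps at a subset of the integers\<close>

text \<open>\<open>lamp_restrict A x\<close> is the canonical representative of the coset \<open>x H\<close>, where \<open>H\<close> consists of
  the lamp configurations that vanish on \<open>A\<close>. The points are singletons only to fit the type.\<close>

definition lamp_restrict :: "int set \<Rightarrow> lamplighter_elem \<Rightarrow> lamplighter_elem" where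
  "lamp_restrict A x = ((\<lambda>i. if i - snd x \<in> A then fst x i else 0), snd x)"

definition lamp_states :: "int set \<Rightarrow> lamplighter_elem set set" where
  "lamp_states A = (\<lambda>x. {lamp_restrict A x}) ` carrier lamplighter"

text \<open>In a point with second component \<open>c\<close>, the entry at \<open>i\<close> is the
  lamp at the site \<open>i - c\<close> of \<open>A\<close>, and the walker stands at
  \<open>- c\<close>. A pure shift on the left thus moves only the walker, and
  \<open>lamps {0}\<close> on the left toggles the lamp under the walker, if there is one.\<close>

definition lamp_action :: "int set \<Rightarrow> lamplighter_elem \<Rightarrow> lamplighter_elem set \<Rightarrow> lamplighter_elem set" where
  "lamp_action A g = (\<lambda>Y\<in>lamp_states A. {lamp_restrict A (g \<otimes>\<^bsub>lamplighter\<^esub> the_elem Y)})"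

text \<open>Left multiplication is well defined on cosets: it moves the lamps and the second
  component by the same amount, so the site of each lamp is unchanged.\<close>

lemma lamp_restrict_mult:
  "lamp_restrict A (g \<otimes>\<^bsub>lamplighter\<^esub> lamp_restrict A x) = lamp_restrict A (g \<otimes>\<^bsub>lamplighter\<^esub> x)"
  by (auto simp: lamp_restrict_def mult_lamplighter_eq fun_eq_iff diff_diff_eq)

lemma lamp_action_eq:
  "x \<in> carrier lamplighter \<Longrightarrow>
    lamp_action A g {lamp_restrict A x} = {lamp_restrict A (g \<otimes>\<^bsub>lamplighter\<^esub> x)}"
  by (auto simp: lamp_action_def lamp_states_def lamp_restrict_mult)

lemma transitive_lamp_action: "transitive_action lamplighter (lamp_states A) (lamp_action A)"
proof -
  interpret L: group lamplighter by (rule group_lamplighter)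
  have "group_action lamplighter (lamp_states A) (lamp_action A)"
  proof (rule L.group_actionI)
    show "lamp_action A g \<in> extensional (lamp_states A)" for g
      by (simp add: lamp_action_def)
  qed (auto simp: lamp_states_def lamp_action_eq L.m_assoc)
  then show ?thesis
  proof (rule transitive_action.intro, unfold_locales)
    fix Y Z assume "Y \<in> lamp_states A" "Z \<in> lamp_states A"
    then obtain y z where y: "y \<in> carrier lamplighter" "Y = {lamp_restrict A y}"
      and z: "z \<in> carrier lamplighter" "Z = {lamp_restrict A z}"
      by (auto simp: lamp_states_def)
    then show "\<exists>g\<in>carrier lamplighter. lamp_action A g Y = Z"
      by (intro bexI[of _ "z \<otimes>\<^bsub>lamplighter\<^esub> inv\<^bsub>lamplighter\<^esub> y"])
        (auto simp: lamp_action_eq L.m_assoc)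
  qed
qed

text \<open>A lamp that is hidden at one point is visible at another. Acting on the dark point with
  second component \<open>i - snd g\<close> puts lamp \<open>i\<close> of \<open>g\<close> at the
  site 0, which lies in \<open>A\<close>.\<close>

lemma faithful_lamp_action:
  assumes "0 \<in> A"
  shows "faithful_action lamplighter (lamp_states A) (lamp_action A)"
proof (rule faithful_action.intro)
  show "group_action lamplighter (lamp_states A) (lamp_action A)"
    using transitive_lamp_action by (rule transitive_action.axioms)
  show "faithful_action_axioms lamplighter (lamp_action A)"
  proof (unfold_locales, rule inj_onI)
    fix g h assume eq: "lamp_action A g = lamp_action A h"
    have "lamp_restrict A (g \<otimes>\<^bsub>lamplighter\<^esub> (lamps {}, q)) =
        lamp_restrict A (h \<otimes>\<^bsub>lamplighter\<^esub> (lamps {}, q))" for q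
      using fun_cong[OF eq, of "{lamp_restrict A (lamps {}, q)}"] by (simp add: lamp_action_eq)
    note * = this[unfolded lamp_restrict_def mult_lamplighter_eq]
    have snd: "snd g = snd h" using *[of 0] by simp
    moreover have "fst g i mod 2 = fst h i mod 2" for i
      using fun_cong[OF arg_cong[OF *[of "i - snd g"], of fst], of i] snd assms by (simp add: lamps_def)
    moreover assume "g \<in> carrier lamplighter" "h \<in> carrier lamplighter"
    ultimately show "g = h"
      by (elim lamplighter_cases) (simp add: lamps_def fun_eq_iff)
  qed
qed


section \<open>Bounds for the orbit of a point under a ball\<close>

abbreviation action_ball ::
    "('a, 'c) monoid_scheme \<Rightarrow> 'a set \<Rightarrow> ('a \<Rightarrow> 'x \<Rightarrow> 'x) \<Rightarrow> nat \<Rightarrow> 'x \<Rightarrow> 'x set" where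
  "action_ball G S \<phi> n x \<equiv> {\<phi> g x | g. g \<in> carrier G \<and> word_length G S g \<le> n}"

text \<open>After \<open>n\<close> steps the walker has one of \<open>2 * N + 1\<close> positions, and only the lamps in a window
  of that length have been switched.\<close>

lemma card_action_ball_le:
  assumes snd: "\<And>g. \<lbrakk>g \<in> carrier lamplighter; word_length lamplighter S g \<le> n\<rbrakk> \<Longrightarrow> \<bar>snd g\<bar> \<le> int N"
    and supp: "\<And>g i. \<lbrakk>g \<in> carrier lamplighter; word_length lamplighter S g \<le> n; fst g i \<noteq> 0\<rbrakk> \<Longrightarrow>
      \<bar>i\<bar> \<le> int N"
    and window: "\<And>p. 2 ^ card (A \<inter> {p..<p + int (2 * N + 1)}) \<le> (B :: real)"
    and Y: "Y \<in> lamp_states A"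
  shows "finite (action_ball lamplighter S (lamp_action A) n Y)"
    and "real (card (action_ball lamplighter S (lamp_action A) n Y)) \<le> real (2 * N + 1) * B"
proof -
  obtain w q where y: "(w, q) \<in> carrier lamplighter" "Y = {lamp_restrict A (w, q)}"
    using Y by (auto simp: lamp_states_def)
  define W where "W c = {- int N..int N} \<inter> {i. i - c \<in> A}" for c
  \<comment> \<open>\<open>F c T\<close> is the image of \<open>Y\<close> under
    \<open>(lamps T, c - q)\<close>: the old lamps \<open>w\<close> travel with the shift
    \<open>c - q\<close>. Only switches in \<open>W c\<close> are visible afterwards, so these are
    the ones to count.\<close>
  define F where "F c T = {((\<lambda>i. if i - c \<in> A then (lamps T i + w (i - (c - q))) mod 2 else 0), c)}"
    for c T
  define U where "U = (\<Union>c\<in>{q - int N..q + int N}. F c ` Pow (W c))"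
  have ball: "action_ball lamplighter S (lamp_action A) n Y \<subseteq> U"
  proof (clarify)
    fix g assume g: "g \<in> carrier lamplighter" "word_length lamplighter S g \<le> n"
    then obtain T b where T: "finite T" "g = (lamps T, b)" by (elim lamplighter_cases)
    have "T \<subseteq> {- int N..int N}"
      using supp[OF g] T by (force simp: lamps_def abs_le_iff)
    then have "T \<inter> {i. i - (b + q) \<in> A} \<in> Pow (W (b + q))" by (auto simp: W_def)
    moreover have "b + q \<in> {q - int N..q + int N}" using snd[OF g] T by auto
    moreover have "lamp_action A g Y = F (b + q) (T \<inter> {i. i - (b + q) \<in> A})"
      unfolding y(2) T(2) lamp_action_eq[OF y(1)]
      by (auto simp: F_def lamp_restrict_def mult_lamplighter_eq lamps_def fun_eq_iff)
    ultimately show "lamp_action A g Y \<in> U" unfolding U_def by blast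
  qed
  have W: "finite (W c)" "2 ^ card (W c) \<le> B" for c
  proof -
    \<comment> \<open>The closed interval has \<open>2 * N + 1\<close> points, which is the length
      of the half-open window in the hypothesis.\<close>
    have "W c = (\<lambda>i. i + c) ` (A \<inter> {- int N - c..<- int N - c + int (2 * N + 1)})"
      by (auto simp: W_def image_iff intro!: bexI[of _ "_ - c"])
    then have "card (W c) = card (A \<inter> {- int N - c..<- int N - c + int (2 * N + 1)})"
      by (simp add: card_image)
    then show "2 ^ card (W c) \<le> B" using window[of "- int N - c"] by simp
  qed (simp add: W_def)
  have "finite U" using W by (auto simp: U_def)
  with ball show "finite (action_ball lamplighter S (lamp_action A) n Y)" by (rule finite_subset)
  have "card (action_ball lamplighter S (lamp_action A) n Y) \<le> card U"
    using \<open>finite U\<close> ball by (rule card_mono)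
  also have "card U \<le> (\<Sum>c\<in>{q - int N..q + int N}. card (F c ` Pow (W c)))"
    unfolding U_def by (rule card_UN_le) simp
  also have "\<dots> \<le> (\<Sum>c\<in>{q - int N..q + int N}. 2 ^ card (W c))"
    using W(1) by (intro sum_mono) (metis card_Pow card_image_le finite_Pow_iff)
  finally have "real (card (action_ball lamplighter S (lamp_action A) n Y)) \<le>
      real (\<Sum>c\<in>{q - int N..q + int N}. 2 ^ card (W c))" by linarith
  also have "\<dots> = (\<Sum>c\<in>{q - int N..q + int N}. 2 ^ card (W c))" by simp
  also have "\<dots> \<le> (\<Sum>c\<in>{q - int N..q + int N}. B)" using W(2) by (intro sum_mono) auto
  also have "\<dots> = real (2 * N + 1) * B" by (simp add: nat_add_distrib)
  finally show "real (card (action_ball lamplighter S (lamp_action A) n Y)) \<le> real (2 * N + 1) * B" .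
qed

text \<open>From the dark point with shift 0, a shift \<open>b\<close> below \<open>m\<close> and a
  set \<open>T\<close> of lit sites below \<open>m\<close> can be chosen independently, and distinct
  choices give distinct points. The site \<open>j\<close> is stored at \<open>b + j\<close>, so the
  switched lamps lie below \<open>2 * m\<close>.\<close>

lemma card_action_ball_ge:
  assumes short: "\<And>T b. \<lbrakk>T \<subseteq> {0..<int (2 * m)}; 0 \<le> b; b \<le> int (2 * m)\<rbrakk> \<Longrightarrow>
      word_length lamplighter S (lamps T, b) \<le> n"
    and fin: "finite (action_ball lamplighter S (lamp_action A) n {lamp_restrict A (lamps {}, 0)})"
  shows "m * 2 ^ card (A \<inter> {0..<int m}) \<le>
    card (action_ball lamplighter S (lamp_action A) n {lamp_restrict A (lamps {}, 0)})"
proof -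
  let ?P = "{0..<int m} \<times> Pow (A \<inter> {0..<int m})"
  let ?F = "\<lambda>(b, T). {(lamps ((+) b ` T), b)}"
  have "inj_on ?F ?P"
  proof (rule inj_onI)
    fix x y assume "?F x = ?F y"
    then have eq: "fst x = fst y" "lamps ((+) (fst x) ` snd x) = lamps ((+) (fst x) ` snd y)"
      by (auto simp: case_prod_beta)
    then have "(+) (fst x) ` snd x = (+) (fst x) ` snd y"
      by (simp add: lamps_def fun_eq_iff of_bool_eq_iff set_eq_iff)
    then show "x = y" using eq(1) by (simp add: inj_image_eq_iff prod_eq_iff)
  qed
  then have "m * 2 ^ card (A \<inter> {0..<int m}) = card (?F ` ?P)"
    by (simp add: card_image card_cartesian_product card_Pow del: Pow_Int_eq)
  also have "?F ` ?P \<subseteq> action_ball lamplighter S (lamp_action A) n {lamp_restrict A (lamps {}, 0)}"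
  proof
    fix z assume "z \<in> ?F ` ?P"
    then obtain b T where b: "b \<in> {0..<int m}" and T: "T \<subseteq> A \<inter> {0..<int m}"
      and z: "z = {(lamps ((+) b ` T), b)}" by auto
    have "(+) b ` T \<subseteq> {0..<int (2 * m)}" using b T by force
    then have "word_length lamplighter S (lamps ((+) b ` T), b) \<le> n" and "finite ((+) b ` T)"
      using b by (auto intro!: short intro: finite_subset)
    moreover have "lamp_action A (lamps ((+) b ` T), b) {lamp_restrict A (lamps {}, 0)} =
        {(lamps ((+) b ` T), b)}"
      unfolding lamp_action_eq[OF lamps_in_carrier[THEN iffD2, OF finite.emptyI]] lamps_mult_shift
      using T by (auto simp: lamp_restrict_def lamps_def fun_eq_iff)
    ultimately show "z \<in> action_ball lamplighter S (lamp_action A) n {lamp_restrict A (lamps {}, 0)}"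
      unfolding z by (intro CollectI exI[of _ "(lamps ((+) b ` T), b)"]) auto
  qed
  \<comment> \<open>Finiteness matters here, as \<open>card\<close> of an infinite set is 0.\<close>
  then have "card (?F ` ?P) \<le> card (action_ball lamplighter S (lamp_action A) n {lamp_restrict A (lamps {}, 0)})"
    using fin by (intro card_mono)
  finally show ?thesis .
qed

section \<open>Placing the lamps\<close>

text \<open>\<open>f (q + m) / f q\<close> is a product of \<open>m\<close> consecutive ratios
  starting at \<open>q\<close>. They are at most the ratios starting at 0, whose product is
  \<open>f m / f 0\<close>. This says that the logarithm of \<open>f / f 0\<close> is
  subadditive.\<close>

lemma log_concave_submult:
  fixes f :: "nat \<Rightarrow> real"
  assumes pos: "\<And>n. f n > 0" and ratio: "antimono (\<lambda>n. f (n + 1) / f n)"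
  shows "f (q + m) * f 0 \<le> f m * f q"
proof (induction m)
  case (Suc m)
  have "f (q + m + 1) / f (q + m) \<le> f (m + 1) / f m"
    using antimonoD[OF ratio, of m "q + m"] by simp
  then have "f (q + m + 1) \<le> f (m + 1) / f m * f (q + m)"
    using pos[of "q + m"] by (simp add: divide_le_eq)
  from mult_right_mono[OF this, of "f 0"]
  have "f (q + Suc m) * f 0 \<le> f (m + 1) / f m * (f (q + m) * f 0)"
    using pos[of 0] by (simp add: mult.assoc)
  also have "\<dots> \<le> f (m + 1) / f m * (f m * f q)"
    using Suc pos[of m] pos[of "m + 1"] by (intro mult_left_mono) auto
  finally show ?case using pos[of m] by simp
qed simp

text \<open>The block \<open>{K * n..<K * (n + 1)}\<close> receives \<open>\<lfloor>g (n + 1)\<rfloor> - \<lfloor>g n\<rfloor>\<close> lamps, where \<open>g\<close> is the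
  logarithm of \<open>f / f 0\<close> to base 2. The additional lamp at 0 is for faithfulness when \<open>g < 1\<close>.\<close>

lemma lamp_placement:
  fixes f :: "nat \<Rightarrow> real"
  assumes mono: "mono f" and pos: "\<And>n. f n > 0" and ratio: "antimono (\<lambda>n. f (n + 1) / f n)"
  obtains K :: nat and A :: "int set" where "K > 0" "0 \<in> A"
    "\<And>m. f m \<le> 2 * f 0 * 2 ^ card (A \<inter> {0..<int (K * m)})"
    "\<And>p m. 2 ^ card (A \<inter> {p..<p + int (K * m)}) \<le> 4 / f 0 * f (m + 1)"
proof -
  define g where "g n = log 2 (f n / f 0)" for n
  define h where "h n = nat \<lfloor>g n\<rfloor>" for n
  have powr_g: "2 powr g n = f n / f 0" for n
    using pos by (simp add: g_def)
  have g_nonneg: "0 \<le> g n" for n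
    using monoD[OF mono, of 0 n] pos by (simp add: g_def)
  have g_mono: "g m \<le> g n" if "m \<le> n" for m n
    using monoD[OF mono that] pos by (simp add: g_def divide_right_mono less_imp_le)
  have g_subadd: "g (q + m) \<le> g m + g q" for q m
  proof -
    have "f (q + m) / f 0 \<le> (f m / f 0) * (f q / f 0)"
      using log_concave_submult[OF pos ratio, of q m] pos[of 0] by (simp add: field_simps)
    then have "g (q + m) \<le> log 2 ((f m / f 0) * (f q / f 0))"
      unfolding g_def using pos by simp
    also have "\<dots> = g m + g q" unfolding g_def using pos[THEN less_imp_neq] by (subst log_mult) force+
    finally show ?thesis .
  qed
  have h: "real (h n) \<le> g n" "g n < real (h n) + 1" for n
    using g_nonneg[of n] by (auto simp: h_def)
  have h_mono: "h m \<le> h n" if "m \<le> n" for m n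
    using g_mono[OF that] by (simp add: h_def nat_mono floor_mono)
  \<comment> \<open>By subadditivity each increment of \<open>g\<close> is at most
    \<open>g 1\<close>. Rounding adds less than 1, so the lamps of a block fit into its length
    \<open>K\<close>; the \<open>+ 1\<close> also keeps \<open>K\<close> positive.\<close>
  define K where "K = nat \<lceil>g 1\<rceil> + 1"
  have "K > 0" by (simp add: K_def)
  have h_step: "h (Suc n) - h n \<le> K" for n
    using h[of n] h[of "Suc n"] g_subadd[of n 1] by (simp add: K_def) linarith
  define M where "M = {K * n + i | n i. i < h (Suc n) - h n}"
  have block: "M \<inter> {K * n..<K * Suc n} = (\<lambda>i. K * n + i) ` {..<h (Suc n) - h n}" for n
  proof (intro equalityI subsetI)
    fix x assume "x \<in> M \<inter> {K * n..<K * Suc n}"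
    then obtain k i where x: "x = K * k + i" "i < h (Suc k) - h k" "K * n \<le> x" "x < K * Suc n"
      by (auto simp: M_def)
    then have "i < K" using h_step[of k] by linarith
    have "x div K = k" using x(1) \<open>i < K\<close> by simp
    moreover have "x div K = n" using x(3,4) by (intro div_nat_eqI) (auto simp: mult.commute)
    ultimately show "x \<in> (\<lambda>i. K * n + i) ` {..<h (Suc n) - h n}" using x by auto
  next
    fix x assume "x \<in> (\<lambda>i. K * n + i) ` {..<h (Suc n) - h n}"
    then show "x \<in> M \<inter> {K * n..<K * Suc n}"
      using h_step[of n] by (auto simp: M_def)
  qed
  \<comment> \<open>The block counts telescope; monotonicity of \<open>h\<close> keeps the natural
    subtractions exact.\<close>
  have count: "card (M \<inter> {K * q..<K * (q + m)}) = h (q + m) - h q" for q m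
  proof (induction m)
    case (Suc m)
    have "M \<inter> {K * q..<K * (q + Suc m)} =
        (M \<inter> {K * q..<K * (q + m)}) \<union> (M \<inter> {K * (q + m)..<K * Suc (q + m)})"
      by (auto simp: algebra_simps)
    moreover have "card (M \<inter> {K * (q + m)..<K * Suc (q + m)}) = h (Suc (q + m)) - h (q + m)"
      unfolding block by (simp add: card_image)
    ultimately have "card (M \<inter> {K * q..<K * (q + Suc m)}) = (h (q + m) - h q) + (h (Suc (q + m)) - h (q + m))"
      using Suc by (simp add: card_Un_disjoint disjoint_iff)
    then show ?case using h_mono[of q "q + m"] h_mono[of "q + m" "Suc (q + m)"] by simp
  qed simp
  define A where "A = insert 0 (int ` M)"
  show ?thesis
  proof (rule that[of K A])
    show "K > 0" "0 \<in> A" by (simp_all add: \<open>K > 0\<close> A_def)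
  next
    fix m
    have "h 0 = 0" using pos[of 0] by (simp add: h_def g_def)
    then have "h m = card (int ` (M \<inter> {K * 0..<K * (0 + m)}))"
      using count[of 0 m] by (simp add: card_image)
    also have "\<dots> \<le> card (A \<inter> {0..<int (K * m)})"
      by (intro card_mono) (auto simp: A_def simp flip: of_nat_mult)
    \<comment> \<open>The 1 is the loss from rounding \<open>g m\<close> down; it becomes the factor
      2 in the bound.\<close>
    finally have "g m \<le> 1 + real (card (A \<inter> {0..<int (K * m)}))" using h(2)[of m] by simp
    then have "f m / f 0 \<le> 2 powr (1 + real (card (A \<inter> {0..<int (K * m)})))"
      by (simp flip: powr_g)
    also have "\<dots> = 2 * 2 ^ card (A \<inter> {0..<int (K * m)})"
      by (simp add: powr_add powr_realpow)
    finally show "f m \<le> 2 * f 0 * 2 ^ card (A \<inter> {0..<int (K * m)})"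
      using pos[of 0] by (simp add: divide_le_eq algebra_simps)
  next
    fix p m
    \<comment> \<open>This is the block where the window starts. For negative \<open>p\<close> it is
      block 0, as \<open>A\<close> has no negative elements. An unaligned window of length
      \<open>K * m\<close> meets at most \<open>m + 1\<close> blocks.\<close>
    define q where "q = nat p div K"
    have q: "K * q \<le> nat p" "nat p < K * q + K"
      using \<open>K > 0\<close> dividend_less_times_div[of K "nat p"] by (auto simp: q_def)
    have "A \<inter> {p..<p + int (K * m)} \<subseteq> insert 0 (int ` (M \<inter> {K * q..<K * (q + (m + 1))}))"
    proof
      fix x assume x: "x \<in> A \<inter> {p..<p + int (K * m)}"
      show "x \<in> insert 0 (int ` (M \<inter> {K * q..<K * (q + (m + 1))}))"
      proof (cases "x = 0")
        case False
        then obtain a where a: "x = int a" "a \<in> M" using x by (auto simp: A_def)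
        then have "p \<le> int a" "int a < p + int (K * m)" using x by auto
        then have "nat p \<le> a" "a < nat p + K * m" by linarith+
        then have "a \<in> {K * q..<K * (q + (m + 1))}" using q by (simp add: algebra_simps)
        then show ?thesis using a by auto
      qed simp
    qed
    then have "card (A \<inter> {p..<p + int (K * m)}) \<le>
        card (insert 0 (int ` (M \<inter> {K * q..<K * (q + (m + 1))})))"
      by (intro card_mono) auto
    also have "\<dots> \<le> Suc (card (int ` (M \<inter> {K * q..<K * (q + (m + 1))})))"
      by (rule card_insert_le_m1) auto
    also have "\<dots> = Suc (h (q + (m + 1)) - h q)"
      by (simp add: card_image count del: add_Suc_right)
    \<comment> \<open>One unit pays for the extra lamp at 0 and one for rounding \<open>g q\<close>
      down; together they give the factor 4.\<close>
    finally have "real (card (A \<inter> {p..<p + int (K * m)})) \<le> 2 + g (m + 1)"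
      using h(2)[of q] h(1)[of "q + (m + 1)"] g_subadd[of q "m + 1"] h_mono[of q "q + (m + 1)"] by linarith
    then have "2 powr real (card (A \<inter> {p..<p + int (K * m)})) \<le> 2 powr (2 + g (m + 1))" by simp
    also have "\<dots> = 4 / f 0 * f (m + 1)" unfolding powr_add powr_g by simp
    finally show "2 ^ card (A \<inter> {p..<p + int (K * m)}) \<le> 4 / f 0 * f (m + 1)"
      by (simp add: powr_realpow)
  qed
qed


section \<open>Growth of the action\<close>

text \<open>The set \<open>A\<close> is fixed before the generating set \<open>S\<close>, which
  enters only through the constants \<open>R\<close> and \<open>D\<close>. These, like
  \<open>K\<close> and \<open>f 0\<close>, are absorbed by the constant in
  \<open>growth_le\<close>.\<close>

lemma has_action_growth_lamp_action:
  fixes f :: "nat \<Rightarrow> real"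
  assumes mono: "mono f" and pos: "\<And>n. f n > 0" and ratio: "antimono (\<lambda>n. f (n + 1) / f n)"
  obtains A where "0 \<in> A"
    "has_action_growth lamplighter (lamp_states A) (lamp_action A) (\<lambda>n. real n * f n)"
proof -
  obtain K :: nat and A :: "int set" where K: "K > 0" and A: "0 \<in> A"
    and dense: "\<And>m. f m \<le> 2 * f 0 * 2 ^ card (A \<inter> {0..<int (K * m)})"
    and sparse: "\<And>p m. 2 ^ card (A \<inter> {p..<p + int (K * m)}) \<le> 4 / f 0 * f (m + 1)"
    by (rule lamp_placement[OF assms]) (rule that)
  have "growth_equiv (\<lambda>n. real (action_growth lamplighter S (lamp_states A) (lamp_action A) n))
      (\<lambda>n. real n * f n)" if S: "fin_sym_gen_set lamplighter S" for S
  proof -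
    let ?vol = "action_growth lamplighter S (lamp_states A) (lamp_action A)"
    let ?ball = "action_ball lamplighter S (lamp_action A)"
    obtain R :: nat where R: "R > 0"
      "\<And>g. g \<in> carrier lamplighter \<Longrightarrow> \<bar>snd g\<bar> \<le> int (R * word_length lamplighter S g)"
      "\<And>g i. \<lbrakk>g \<in> carrier lamplighter; fst g i \<noteq> 0\<rbrakk> \<Longrightarrow> \<bar>i\<bar> \<le> int (R * word_length lamplighter S g)"
      by (rule word_length_lamplighter_support[OF S]) (rule that)
    obtain D :: nat where D: "D > 0"
      "\<And>T b m. \<lbrakk>T \<subseteq> {0..<int m}; 0 \<le> b; b \<le> int m\<rbrakk> \<Longrightarrow>
         word_length lamplighter S (lamps T, b) \<le> D * m"
      by (rule word_length_lamplighter_upper[OF S]) (rule that)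
    have window: "2 ^ card (A \<inter> {p..<p + int (2 * (R * n) + 1)}) \<le> 4 / f 0 * f (2 * R * n + 2)" for p n
    proof -
      have "2 * (R * n) + 1 \<le> K * (2 * R * n + 1)" using K by (cases K) auto
      then have "int (2 * (R * n) + 1) \<le> int (K * (2 * R * n + 1))" by (simp only: of_nat_le_iff)
      then have "card (A \<inter> {p..<p + int (2 * (R * n) + 1)}) \<le> card (A \<inter> {p..<p + int (K * (2 * R * n + 1))})"
        by (intro card_mono) auto
      then have "(2::real) ^ card (A \<inter> {p..<p + int (2 * (R * n) + 1)}) \<le>
          2 ^ card (A \<inter> {p..<p + int (K * (2 * R * n + 1))})" by simp
      also have "\<dots> \<le> 4 / f 0 * f (2 * R * n + 1 + 1)" by (rule sparse)
      finally show ?thesis by simp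
    qed
    have le: "R * word_length lamplighter S g \<le> R * n" if "word_length lamplighter S g \<le> n" for g n
      using that by simp
    have snd: "\<bar>snd g\<bar> \<le> int (R * n)"
      if "g \<in> carrier lamplighter" "word_length lamplighter S g \<le> n" for g n
      using R(2)[OF that(1)] le[OF that(2)] by linarith
    have supp: "\<bar>i\<bar> \<le> int (R * n)"
      if "g \<in> carrier lamplighter" "word_length lamplighter S g \<le> n" "fst g i \<noteq> 0" for g i n
      using R(3)[OF that(1,3)] le[OF that(2)] by linarith
    define B where "B n = real (2 * (R * n) + 1) * (4 / f 0 * f (2 * R * n + 2))" for n
    have finite_ball: "finite (?ball n Y)" and card_ball: "real (card (?ball n Y)) \<le> B n"
      if "Y \<in> lamp_states A" for Y n
      unfolding B_def using card_action_ball_le[OF snd supp window that] by auto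
    \<comment> \<open>There may be infinitely many points, so \<open>Max\<close> is meaningful only
      because \<open>B n\<close> bounds all balls uniformly.\<close>
    have fin: "finite ((\<lambda>Y. card (?ball n Y)) ` lamp_states A)" for n
    proof (rule finite_subset)
      show "(\<lambda>Y. card (?ball n Y)) ` lamp_states A \<subseteq> {..nat \<lfloor>B n\<rfloor>}"
        using card_ball by (auto simp: le_nat_floor)
    qed simp
    define base where "base = {lamp_restrict A (lamps {}, 0)}"
    have base: "base \<in> lamp_states A" by (auto simp: base_def lamp_states_def)
    have vol_le: "real (?vol n) \<le> B n" for n
    proof -
      have "?vol n \<in> (\<lambda>Y. card (?ball n Y)) ` lamp_states A"
        unfolding action_growth_def using fin base by (intro Max_in) auto
      then show ?thesis using card_ball by auto
    qed
    have vol_ge: "m * 2 ^ card (A \<inter> {0..<int m}) \<le> ?vol n" if n: "D * (2 * m) \<le> n" for m n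
    proof -
      have short: "word_length lamplighter S (lamps T, b) \<le> n"
        if "T \<subseteq> {0..<int (2 * m)}" "0 \<le> b" "b \<le> int (2 * m)" for T b
        using D(2)[OF that] n by linarith
      have "m * 2 ^ card (A \<inter> {0..<int m}) \<le> card (?ball n base)"
        unfolding base_def
        by (rule card_action_ball_ge[OF short finite_ball[OF base, unfolded base_def]])
      also have "\<dots> \<le> ?vol n"
        unfolding action_growth_def using fin base by (intro Max_ge) auto
      finally show ?thesis .
    qed
    have "growth_le (\<lambda>n. real (?vol n)) (\<lambda>n. real n * f n)"
    proof -
      obtain k :: nat where k: "4 / f 0 \<le> real k" using real_arch_simple by blast
      \<comment> \<open>The factor \<open>4 * R\<close> covers \<open>2 * R * n + 2\<close> once
        \<open>n\<close> is at least 1, and \<open>k + 1\<close> covers the coefficient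
        \<open>4 / f 0\<close>.\<close>
      define C where "C = 4 * R * (k + 1)"
      have C: "4 * R \<le> C" by (simp add: C_def)
      have "k \<le> C" using R(1) mult_le_mono[of 1 "4 * R" k "k + 1"] by (simp add: C_def)
      with k have C': "4 / f 0 \<le> real C" by linarith
      have "real (?vol n) \<le> real C * (real (C * n) * f (C * n))" if n: "n \<ge> 1" for n
      proof -
        have "1 \<le> R * n" using R(1) n by simp
        moreover have "4 * (R * n) \<le> C * n" using mult_right_mono[OF C, of n] by simp
        ultimately have "2 * (R * n) + 1 \<le> C * n" and "2 * R * n + 2 \<le> C * n" by (simp_all, linarith+)
        then have "B n \<le> real (C * n) * (real C * f (C * n))"
          unfolding B_def using pos C' monoD[OF mono]
          by (intro mult_mono) (auto intro: less_imp_le simp del: of_nat_mult of_nat_add)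
        then show ?thesis using vol_le[of n] by (simp add: algebra_simps)
      qed
      moreover have "C > 0" using R(1) C by linarith
      ultimately show ?thesis
        unfolding growth_le_def by (blast intro: eventually_sequentiallyI[of 1])
    qed
    moreover have "growth_le (\<lambda>n. real n * f n) (\<lambda>n. real (?vol n))"
    proof -
      obtain k :: nat where k: "2 * f 0 \<le> real k" using real_arch_simple by blast
      \<comment> \<open>Time \<open>2 * D * K * n\<close> suffices for the lower bound with
        \<open>m = K * n\<close>, the window in which \<open>dense\<close> finds enough lamps;
        \<open>k + 1\<close> covers \<open>2 * f 0\<close>.\<close>
      define C where "C = 2 * D * K * (k + 1)"
      have C: "2 * D * K \<le> C" by (simp add: C_def)
      have "k \<le> C" using D(1) K mult_le_mono[of 1 "2 * D * K" k "k + 1"] by (simp add: C_def)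
      with k have C': "2 * f 0 \<le> real C" by linarith
      have "real n * f n \<le> real C * real (?vol (C * n))" for n
      proof -
        have "real n * f n \<le> real (K * n) * (2 * f 0 * 2 ^ card (A \<inter> {0..<int (K * n)}))"
        proof (intro mult_mono)
          have "n \<le> K * n" using K by (cases K) auto
          then show "real n \<le> real (K * n)" by (simp only: of_nat_le_iff)
        qed (use dense[of n] pos[of n] in auto)
        also have "\<dots> = 2 * f 0 * real (K * n * 2 ^ card (A \<inter> {0..<int (K * n)}))" by simp
        also have "\<dots> \<le> real C * real (?vol (C * n))"
          using C' vol_ge[of "K * n" "C * n"] mult_right_mono[OF C, of n] pos[of 0]
          by (intro mult_mono) (auto simp: mult.assoc mult.left_commute simp del: of_nat_mult)
        finally show ?thesis .
      qed
      moreover have "C > 0" using D(1) K by (simp add: C_def)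
      ultimately show ?thesis
        unfolding growth_le_def by (intro exI[of _ C]) auto
    qed
    ultimately show ?thesis by (simp add: growth_equiv_def)
  qed
  then show ?thesis using that A by (simp add: has_action_growth_def)
qed

section \<open>Growth equivalences for the power and exponential cases\<close>

lemma growth_le_trans:
  assumes "growth_le f g" "growth_le g h"
  shows "growth_le f h"
proof -
  obtain C where C: "C > 0" "\<forall>\<^sub>F n in sequentially. f n \<le> real C * g (C * n)"
    using assms(1) unfolding growth_le_def by blast
  obtain D where D: "D > 0" "\<forall>\<^sub>F n in sequentially. g n \<le> real D * h (D * n)"
    using assms(2) unfolding growth_le_def by blast
  \<comment> \<open>The second estimate is used at \<open>C * n\<close>, so it has to hold
    eventually along these multiples.\<close>
  have "filterlim (\<lambda>n. C * n) sequentially sequentially"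
    using C(1) by (simp add: filterlim_subseq strict_mono_def)
  from C(2) filterlim_iff[THEN iffD1, rule_format, OF this D(2)]
  have "\<forall>\<^sub>F n in sequentially. f n \<le> real (D * C) * h (D * C * n)"
  proof eventually_elim
    case (elim n)
    then show ?case
      using mult_left_mono[of "g (C * n)" "real D * h (D * (C * n))" "real C"] by (simp add: ac_simps)
  qed
  then show ?thesis using C(1) D(1) unfolding growth_le_def by (intro exI[of _ "D * C"]) simp
qed

lemma has_action_growth_cong:
  "\<lbrakk>has_action_growth G X \<phi> F; growth_equiv F F'\<rbrakk> \<Longrightarrow> has_action_growth G X \<phi> F'"
  unfolding has_action_growth_def growth_equiv_def by (blast intro: growth_le_trans)

text \<open>The shift by 1 keeps the factor multiplying \<open>n\<close> positive at
  \<open>n = 0\<close>, where \<open>real n powr (a - 1)\<close> is 0. It is harmless because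
  \<open>n + 1\<close> lies between \<open>n\<close> and \<open>2 * n\<close> for positive
  \<open>n\<close>.\<close>

lemma growth_equiv_powr:
  fixes a :: real
  assumes "a \<ge> 1"
  shows "growth_equiv (\<lambda>n. real n * (real n + 1) powr (a - 1)) (\<lambda>n. real n powr a)"
proof -
  have eq: "real n powr a = real n * real n powr (a - 1)" if "n \<ge> 1" for n
    using that by (simp add: powr_mult_base)
  have "real n * (real n + 1) powr (a - 1) \<le> real 2 * real (2 * n) powr a" if "n \<ge> 1" for n
  proof -
    have "real n * (real n + 1) powr (a - 1) \<le> real (2 * n) * real (2 * n) powr (a - 1)"
      using that assms by (intro mult_mono powr_mono2) auto
    also have "\<dots> = real (2 * n) powr a" using that eq[of "2 * n"] by simp
    also have "\<dots> \<le> real 2 * real (2 * n) powr a" by simp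
    finally show ?thesis .
  qed
  moreover have "real n powr a \<le> real 1 * (real (1 * n) * (real (1 * n) + 1) powr (a - 1))" if "n \<ge> 1" for n
    using that assms by (simp add: eq powr_mono2)
  ultimately show ?thesis
    unfolding growth_equiv_def growth_le_def
    by (intro conjI exI[of _ 1] exI[of _ 2] eventually_sequentiallyI[of 1]) auto
qed

text \<open>Eventually \<open>n\<close> is at most \<open>exp (real n powr b)\<close>, so the extra
  factor only doubles the exponent. Choosing \<open>C\<close> with \<open>real C powr b\<close> at
  least 2 turns the doubling into a rescaling of \<open>n\<close>.\<close>

lemma growth_equiv_exp_powr:
  fixes b :: real
  assumes "b > 0"
  shows "growth_equiv (\<lambda>n. real n * exp (real n powr b)) (\<lambda>n. exp (real n powr b))"
proof -
  define C where "C = nat \<lceil>2 powr (1 / b)\<rceil>"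
  have "2 powr (1 / b) \<le> real C" by (simp add: C_def)
  then have "(2 powr (1 / b)) powr b \<le> real C powr b" using assms by (intro powr_mono2) auto
  then have C: "2 \<le> real C powr b" using assms by (simp add: powr_powr)
  have "C > 0" by (simp add: C_def)
  have "\<forall>\<^sub>F n in sequentially. real n \<le> exp (real n powr b)"
    using assms by real_asymp
  then have "\<forall>\<^sub>F n in sequentially. real n * exp (real n powr b) \<le> real C * exp (real (C * n) powr b)"
  proof eventually_elim
    case (elim n)
    have "real n * exp (real n powr b) \<le> exp (real n powr b) * exp (real n powr b)"
      using elim by simp
    also have "\<dots> = exp (2 * real n powr b)" by (simp flip: exp_add)
    also have "\<dots> \<le> exp (real (C * n) powr b)" using C by (simp add: powr_mult mult_right_mono)
    also have "\<dots> \<le> real C * exp (real (C * n) powr b)" using \<open>C > 0\<close> by (simp add: Suc_le_eq)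
    finally show ?case .
  qed
  then have "growth_le (\<lambda>n. real n * exp (real n powr b)) (\<lambda>n. exp (real n powr b))"
    using \<open>C > 0\<close> unfolding growth_le_def by blast
  moreover have "growth_le (\<lambda>n. exp (real n powr b)) (\<lambda>n. real n * exp (real n powr b))"
    unfolding growth_le_def by (intro exI[of _ 1] conjI eventually_sequentiallyI[of 1]) auto
  ultimately show ?thesis by (simp add: growth_equiv_def)
qed

text \<open>This is concavity of the power function for exponents at most 1: the derivative of the
  increment is non-positive because \<open>x powr (b - 1)\<close> is non-increasing.\<close>

lemma powr_increment_antimono:
  fixes b :: real
  assumes b: "0 < b" "b \<le> 1"
  shows "antimono (\<lambda>n. real (n + 1) powr b - real n powr b)"
proof (subst antimono_iff_le_Suc, intro allI)
  fix n :: nat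
  define g where "g x = (x + 1) powr b - x powr b" for x :: real
  have "g (real n + 1) \<le> g (real n)"
  \<comment> \<open>The version for open intervals asks only for continuity at the ends; for
    \<open>n = 0\<close> and \<open>b < 1\<close> the function has no derivative at 0.\<close>
  proof (rule DERIV_nonpos_imp_decreasing_open[of "real n" "real n + 1" g])
    fix x :: real assume "real n < x"
    then have x: "0 < x" by linarith
    have "(g has_real_derivative b * (x + 1) powr (b - 1) - b * x powr (b - 1)) (at x)"
      unfolding g_def using x by (auto intro!: derivative_eq_intros)
    moreover have "(x + 1) powr (b - 1) \<le> x powr (b - 1)"
      using b x by (intro powr_mono2') auto
    then have "b * (x + 1) powr (b - 1) - b * x powr (b - 1) \<le> 0"
      using b by (simp add: mult_left_mono)
    ultimately show "\<exists>y. (g has_real_derivative y) (at x) \<and> y \<le> 0" by blast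
  next
    show "continuous_on {real n..real n + 1} g"
      unfolding g_def using b by (intro continuous_intros continuous_on_powr') auto
  qed simp
  then show "real (Suc n + 1) powr b - real (Suc n) powr b \<le> real (n + 1) powr b - real n powr b"
    by (simp add: g_def algebra_simps)
qed

theorem proposition2p3:
  shows
    "(\<forall>f :: nat \<Rightarrow> real.
        mono f \<longrightarrow> (\<forall>n. f n > 0) \<longrightarrow> antimono (\<lambda>n. f (n + 1) / f n) \<longrightarrow>
        (\<exists>(X :: lamplighter_elem set set) \<phi>.
           X \<noteq> {} \<and> faithful_action lamplighter X \<phi> \<and> transitive_action lamplighter X \<phi> \<and>
           has_action_growth lamplighter X \<phi> (\<lambda>n. real n * f n))) \<and>
     (\<forall>\<alpha> :: real. \<alpha> \<ge> 1 \<longrightarrow>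
        (\<exists>(X :: lamplighter_elem set set) \<phi>.
           X \<noteq> {} \<and> faithful_action lamplighter X \<phi> \<and>
           has_action_growth lamplighter X \<phi> (\<lambda>n. real n powr \<alpha>))) \<and>
     (\<forall>\<beta> :: real. 0 < \<beta> \<longrightarrow> \<beta> \<le> 1 \<longrightarrow>
        (\<exists>(X :: lamplighter_elem set set) \<phi>.
           X \<noteq> {} \<and> faithful_action lamplighter X \<phi> \<and>
           has_action_growth lamplighter X \<phi> (\<lambda>n. exp (real n powr \<beta>))))"
proof -
  have nf: "\<exists>(X :: lamplighter_elem set set) \<phi>.
      X \<noteq> {} \<and> faithful_action lamplighter X \<phi> \<and> transitive_action lamplighter X \<phi> \<and>
      has_action_growth lamplighter X \<phi> (\<lambda>n. real n * f n)"
    if f: "mono f" "\<And>n. f n > 0" "antimono (\<lambda>n. f (n + 1) / f n)" for f :: "nat \<Rightarrow> real"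
  proof -
    obtain A where A: "0 \<in> A"
      "has_action_growth lamplighter (lamp_states A) (lamp_action A) (\<lambda>n. real n * f n)"
      by (rule has_action_growth_lamp_action[OF f]) (rule that)
    moreover have "lamp_states A \<noteq> {}"
      unfolding lamp_states_def using lamps_in_carrier[of "{}" 0] by blast
    ultimately show ?thesis using faithful_lamp_action transitive_lamp_action by blast
  qed
  show ?thesis
  proof (intro conjI allI impI)
    fix f :: "nat \<Rightarrow> real"
    assume "mono f" "\<forall>n. f n > 0" "antimono (\<lambda>n. f (n + 1) / f n)"
    then show "\<exists>(X :: lamplighter_elem set set) \<phi>.
        X \<noteq> {} \<and> faithful_action lamplighter X \<phi> \<and> transitive_action lamplighter X \<phi> \<and>
        has_action_growth lamplighter X \<phi> (\<lambda>n. real n * f n)"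
      by (intro nf) auto
  next
    fix a :: real assume a: "a \<ge> 1"
    define f where "f n = (real n + 1) powr (a - 1)" for n
    have "mono f" unfolding f_def using a by (intro monoI powr_mono2) auto
    moreover have "f n > 0" for n by (simp add: f_def)
    moreover have "antimono (\<lambda>n. f (n + 1) / f n)"
    proof (rule antimonoI)
      fix m n :: nat assume "m \<le> n"
      have eq: "f (k + 1) / f k = (1 + 1 / (real k + 1)) powr (a - 1)" for k
      proof -
        have "1 + 1 / (real k + 1) = (real (k + 1) + 1) / (real k + 1)" by (simp add: field_simps)
        then show ?thesis by (simp add: f_def powr_divide)
      qed
      show "f (n + 1) / f n \<le> f (m + 1) / f m"
        unfolding eq using a \<open>m \<le> n\<close> by (intro powr_mono2 add_left_mono divide_left_mono) auto
    qed
    ultimately obtain X :: "lamplighter_elem set set" and \<phi> where "X \<noteq> {}" "faithful_action lamplighter X \<phi>"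
      and growth: "has_action_growth lamplighter X \<phi> (\<lambda>n. real n * f n)"
      using nf[of f] by auto
    moreover have "has_action_growth lamplighter X \<phi> (\<lambda>n. real n powr a)"
      using growth growth_equiv_powr[OF a] unfolding f_def by (rule has_action_growth_cong)
    ultimately show "\<exists>(X :: lamplighter_elem set set) \<phi>.
        X \<noteq> {} \<and> faithful_action lamplighter X \<phi> \<and>
        has_action_growth lamplighter X \<phi> (\<lambda>n. real n powr a)"
      by (intro exI conjI)
  next
    fix b :: real assume b: "0 < b" "b \<le> 1"
    define f where "f n = exp (real n powr b)" for n
    have "mono f" unfolding f_def using b by (intro monoI) (simp add: powr_mono2)
    moreover have "f n > 0" for n by (simp add: f_def)
    \<comment> \<open>The ratio is the exponential of the increment of
      \<open>real n powr b\<close>.\<close>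
    moreover have "antimono (\<lambda>n. f (n + 1) / f n)"
      using powr_increment_antimono[OF b] unfolding f_def exp_diff[symmetric] antimono_def by simp
    ultimately obtain X :: "lamplighter_elem set set" and \<phi> where "X \<noteq> {}" "faithful_action lamplighter X \<phi>"
      and growth: "has_action_growth lamplighter X \<phi> (\<lambda>n. real n * f n)"
      using nf[of f] by auto
    moreover have "has_action_growth lamplighter X \<phi> (\<lambda>n. exp (real n powr b))"
      using growth growth_equiv_exp_powr[OF b(1)] unfolding f_def by (rule has_action_growth_cong)
    ultimately show "\<exists>(X :: lamplighter_elem set set) \<phi>.
        X \<noteq> {} \<and> faithful_action lamplighter X \<phi> \<and>
        has_action_growth lamplighter X \<phi> (\<lambda>n. exp (real n powr b))"
      by (intro exI conjI)
  qed
qed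

end
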